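(* Consider an ergodic time-reversible discrete-time Markov chain $X$ on a finite state space (with at least two states) with transition matrix $P$ and stationary distribution $\pi$, and let $0$ be a fixed state. Assume that $P^t(0,0)$ is nonincreasing in $t\in\{0,1,2,\ldots\}$. Let $V$ be a random variable (with values in $\{0,1,2,\ldots\}$) with $$\mathbf P(V>t)=\frac{P^t(0,0)-\pi(0)}{1-\pi(0)},\qquad t=0,1,\ldots.$$ Let $V_1,V_2,\ldots$ be i.i.d. copies of $V$, and let $N$ be independent of the sequence $(V_i)$ with $N+1$ distributed Geometric with success probability $\pi(0)$: $$\mathbf P(N=k)=\pi(0)[1-\pi(0)]^k,\qquad k=0,1,\ldots.$$ Then the law of the nonnegative hitting time $T_0=\min\{t\ge0:X_t=0\}$ of state $0$ when $X_0\sim\pi$ is the law of $\sum_{i=1}^N V_i$.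
   Context: Ergodic means irreducible and aperiodic. $P^t(0,0)$ is the $(0,0)$ entry of the matrix power $P^t$. *)

theory Defs
  imports "HOL-Probability.Probability"
begin

text \<open>
  A finite state space is a type \<open>'a :: finite\<close>; a transition matrix \<open>P :: real^'a^'a\<close> has
  \<open>P $ i $ j\<close> as the probability of moving from \<open>i\<close> to \<open>j\<close>, and distributions are row
  vectors.
\<close>

text \<open>The operator \<open>^\<close> on \<open>real^'a^'a\<close> is the entrywise power, hence the following definition.\<close>

primrec matrix_power :: "real^'a^'a \<Rightarrow> nat \<Rightarrow> real^'a^'a :: finite" where
  "matrix_power A 0 = mat 1"
| "matrix_power A (Suc t) = matrix_power A t ** A"

definition stochastic_matrix :: "real^'a^'a :: finite \<Rightarrow> bool" where
  "stochastic_matrix P \<longleftrightarrow> (\<forall>i j. 0 \<le> P $ i $ j) \<and> (\<forall>i. (\<Sum>j\<in>UNIV. P $ i $ j) = 1)"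

definition probability_vector :: "real^'a :: finite \<Rightarrow> bool" where
  "probability_vector \<mu> \<longleftrightarrow> (\<forall>i. 0 \<le> \<mu> $ i) \<and> (\<Sum>i\<in>UNIV. \<mu> $ i) = 1"

definition irreducible_chain :: "real^'a^'a :: finite \<Rightarrow> bool" where
  "irreducible_chain P \<longleftrightarrow> (\<forall>i j. \<exists>t. 0 < matrix_power P t $ i $ j)"

definition period :: "real^'a^'a :: finite \<Rightarrow> 'a \<Rightarrow> nat" where
  "period P i = Gcd {t. 0 < t \<and> 0 < matrix_power P t $ i $ i}"

definition aperiodic_chain :: "real^'a^'a :: finite \<Rightarrow> bool" where
  "aperiodic_chain P \<longleftrightarrow> (\<forall>i. period P i = 1)"

definition ergodic_chain :: "real^'a^'a :: finite \<Rightarrow> bool" where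
  "ergodic_chain P \<longleftrightarrow> irreducible_chain P \<and> aperiodic_chain P"

definition stationary_distribution :: "real^'a^'a :: finite \<Rightarrow> real^'a \<Rightarrow> bool" where
  "stationary_distribution P \<pi> \<longleftrightarrow> probability_vector \<pi> \<and> \<pi> v* P = \<pi>"

definition time_reversible :: "real^'a^'a :: finite \<Rightarrow> real^'a \<Rightarrow> bool" where
  "time_reversible P \<pi> \<longleftrightarrow> (\<forall>i j. \<pi> $ i * P $ i $ j = \<pi> $ j * P $ j $ i)"

text \<open>
  The Markov property: the conditional probability is required to be \<open>P $ x t $ j\<close> only given
  histories of positive probability, since \<open>cond_prob\<close> is \<open>0\<close> otherwise.
\<close>

definition markov_chain ::
  "'w measure \<Rightarrow> (nat \<Rightarrow> 'w \<Rightarrow> 'a) \<Rightarrow> real^'a^'a :: finite \<Rightarrow> real^'a \<Rightarrow> bool" where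
  "markov_chain M X P \<mu> \<longleftrightarrow>
     prob_space M \<and>
     (\<forall>t. X t \<in> measurable M (count_space UNIV)) \<and>
     (\<forall>i. \<P>(\<omega> in M. X 0 \<omega> = i) = \<mu> $ i) \<and>
     (\<forall>t x j. 0 < \<P>(\<omega> in M. \<forall>s\<le>t. X s \<omega> = x s) \<longrightarrow>
        \<P>(\<omega> in M. X (Suc t) \<omega> = j \<bar> \<forall>s\<le>t. X s \<omega> = x s) = P $ x t $ j)"

text \<open>The hitting time is \<open>\<infinity>\<close> on paths that never visit \<open>i\<close>, by \<open>Inf {} = \<infinity>\<close> on \<open>enat\<close>.\<close>

definition hitting_time :: "(nat \<Rightarrow> 'w \<Rightarrow> 'a) \<Rightarrow> 'a \<Rightarrow> 'w \<Rightarrow> enat" where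
  "hitting_time X i \<omega> = Inf {enat t | t. X t \<omega> = i}"

end

theory Submission
  imports Defs
begin

text \<open>
  Write \<open>p = \<pi>(z)\<close>, and let \<open>A\<close>, \<open>F\<close>, \<open>G\<close>, \<open>H\<close> be the generating functions of \<open>P\<^sup>t(z,z)\<close>, of the
  hitting time, of \<open>V\<close> and of the random sum. Splitting the event \<open>X\<^sub>n = z\<close> by the first visit to
  \<open>z\<close> gives \<open>F A = p / (1 - x)\<close>. The tail formula for \<open>V\<close> says \<open>(1 - p) G = 1 - (1 - x) A\<close>, so
  \<open>H = p / (1 - (1 - p) G) = p / ((1 - x) A) = F\<close> as formal power series.
\<close>

section \<open>Hitting times and laws on \<open>enat\<close>\<close>

text \<open>Since \<open>enat\<close> is well-ordered, the infimum of a nonempty set is attained.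
  The resulting event depends on the path up to time \<open>t\<close> only, the form that
  measurability and the Markov property require.\<close>

lemma hitting_time_eq_iff:
  "hitting_time X i \<omega> = enat t \<longleftrightarrow> X t \<omega> = i \<and> (\<forall>s<t. X s \<omega> \<noteq> i)"
proof
  let ?S = "{enat t | t. X t \<omega> = i}"
  assume t: "hitting_time X i \<omega> = enat t"
  then have "?S \<noteq> {}"
    unfolding hitting_time_def Inf_enat_def by (metis (lifting) enat.distinct(1))
  then have "Inf ?S \<in> ?S"
    unfolding Inf_enat_def by (metis (lifting) LeastI_ex ex_in_conv)
  moreover have "Inf ?S \<le> enat s" if "X s \<omega> = i" for s
    using that by (auto intro: Inf_lower)
  ultimately show "X t \<omega> = i \<and> (\<forall>s<t. X s \<omega> \<noteq> i)"
    using t by (fastforce simp: hitting_time_def)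
next
  assume "X t \<omega> = i \<and> (\<forall>s<t. X s \<omega> \<noteq> i)"
  then show "hitting_time X i \<omega> = enat t"
    unfolding hitting_time_def
    by (intro antisym Inf_lower Inf_greatest) (auto simp: not_less[symmetric])
qed

text \<open>The mass at infinity is one minus the sum of the finite masses, so the finite masses
  determine the law. Almost sure finiteness of the hitting time therefore need not be proved
  beforehand.\<close>

lemma prob_space_eqI_enat:
  assumes "prob_space A" "prob_space B" "sets A = UNIV" "sets B = UNIV"
    and eq: "\<And>n. measure A {enat n} = measure B {enat n}"
  shows "A = B"
proof -
  interpret A: prob_space A by fact
  interpret B: prob_space B by fact
  have space: "space A = UNIV" "space B = UNIV"
    using assms(3,4) by (metis UNIV_I sets.sets_into_space top.extremum_uniqueI)+
  have sums: "(\<lambda>n. measure C {enat n}) sums measure C (range enat)"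
    if "prob_space C" "sets C = UNIV" for C
  proof -
    interpret C: prob_space C by fact
    have "(\<lambda>n. measure C {enat n}) sums measure C (\<Union>n. {enat n})"
      using that(2) by (intro C.finite_measure_UNION) (auto simp: disjoint_family_on_def)
    also have "(\<Union>n. {enat n}) = range enat"
      by auto
    finally show ?thesis .
  qed
  have range: "measure A (range enat) = measure B (range enat)"
    using sums[OF assms(1,3)] sums[OF assms(2,4)] unfolding eq by (rule sums_unique2)
  have "x \<in> {\<infinity>} \<longleftrightarrow> x \<in> UNIV - range enat" for x
    by (cases x) auto
  then have inf: "{\<infinity>} = UNIV - range enat"
    by blast
  have "measure A {\<infinity>} = measure B {\<infinity>}"
    using A.prob_compl[of "range enat"] B.prob_compl[of "range enat"] assms(3,4) space range inf
    by simp
  then have "measure A {x} = measure B {x}" for x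
    using eq by (cases x) auto
  then show ?thesis
    using assms(3,4)
    by (intro measure_eqI_countable[where A = UNIV])
       (auto simp: A.emeasure_eq_measure B.emeasure_eq_measure)
qed

subsection \<open>Finite Markov chains\<close>

lemma markov_chain_prob_space: "markov_chain M X P \<mu> \<Longrightarrow> prob_space M"
  by (simp add: markov_chain_def)

lemma markov_chain_measurable: "markov_chain M X P \<mu> \<Longrightarrow> X t \<in> measurable M (count_space UNIV)"
  by (simp add: markov_chain_def)

text \<open>Product form of the Markov property. It covers null histories too: there both sides
  vanish, the left one by monotonicity.\<close>

lemma markov_chain_path_step:
  assumes "markov_chain M X P \<mu>"
  shows "\<P>(\<omega> in M. (\<forall>s\<le>n. X s \<omega> = x s) \<and> X (Suc n) \<omega> = j)
       = \<P>(\<omega> in M. \<forall>s\<le>n. X s \<omega> = x s) * P $ x n $ j"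
proof -
  interpret prob_space M using assms by (rule markov_chain_prob_space)
  note [measurable] = markov_chain_measurable[OF assms]
  show ?thesis
  proof (cases "\<P>(\<omega> in M. \<forall>s\<le>n. X s \<omega> = x s) = 0")
    case True
    have "\<P>(\<omega> in M. (\<forall>s\<le>n. X s \<omega> = x s) \<and> X (Suc n) \<omega> = j)
        \<le> \<P>(\<omega> in M. \<forall>s\<le>n. X s \<omega> = x s)"
      by (intro finite_measure_mono) auto
    then show ?thesis
      using True by (simp add: measure_le_0_iff)
  next
    case False
    then have "0 < \<P>(\<omega> in M. \<forall>s\<le>n. X s \<omega> = x s)"
      by (simp add: zero_less_measure_iff)
    then have "\<P>(\<omega> in M. X (Suc n) \<omega> = j \<bar> \<forall>s\<le>n. X s \<omega> = x s) = P $ x n $ j"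
      using assms by (simp add: markov_chain_def)
    then show ?thesis
      using False by (simp add: cond_prob_def field_simps conj_commute)
  qed
qed

text \<open>An event \<open>Q\<close> about the first \<open>n + 1\<close> states is a finite
  disjoint union of events fixing the whole path up to time \<open>n\<close>. This yields
  measurability, and summing the one-path identity over the paths yields the step.\<close>

lemma
  fixes P :: "real^'a^'a :: finite"
  assumes chain: "markov_chain M X P \<mu>"
    and hist: "\<And>x y. (\<forall>s\<le>n. x s = y s) \<Longrightarrow> Q x = Q y"
  shows markov_chain_history_measurable: "{\<omega> \<in> space M. Q (\<lambda>s. X s \<omega>)} \<in> sets M"
    and markov_chain_step:
      "\<P>(\<omega> in M. (Q (\<lambda>s. X s \<omega>) \<and> X n \<omega> = k) \<and> X (Suc n) \<omega> = j)
       = \<P>(\<omega> in M. Q (\<lambda>s. X s \<omega>) \<and> X n \<omega> = k) * P $ k $ j"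
proof -
  interpret prob_space M using chain by (rule markov_chain_prob_space)
  note [measurable] = markov_chain_measurable[OF chain]
  \<comment> \<open>Extensional functions on \<open>{..n}\<close> give each history exactly one
    representative, and there are finitely many because the state space is finite.\<close>
  define paths where "paths R = {x \<in> PiE {..n} (\<lambda>_. UNIV). R x}" for R :: "(nat \<Rightarrow> 'a) \<Rightarrow> bool"
  have finite: "finite (paths R)" for R
    unfolding paths_def by (rule finite_subset[OF _ finite_PiE[of "{..n}" "\<lambda>_. UNIV"]]) auto
  have paths_iff: "restrict y {..n} \<in> paths R \<longleftrightarrow> R y"
    if "\<And>x y. (\<forall>s\<le>n. x s = y s) \<Longrightarrow> R x = R y" for R y
    using that[of "restrict y {..n}" y] by (auto simp: paths_def)
  have path_eq: "(\<forall>s\<le>n. y s = x s) \<longleftrightarrow> x = restrict y {..n}" if "x \<in> paths R" for x y R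
    using that by (auto simp: paths_def fun_eq_iff PiE_def extensional_def)
  have ex1: "\<exists>!x\<in>paths R. \<forall>s\<le>n. y s = x s"
    if "\<And>x y. (\<forall>s\<le>n. x s = y s) \<Longrightarrow> R x = R y" "R y" for R y
  proof
    show "restrict y {..n} \<in> paths R \<and> (\<forall>s\<le>n. y s = restrict y {..n} s)"
      using paths_iff[of R y] that by simp
  qed (use path_eq in blast)
  have pathsD: "R y"
    if "\<And>x y. (\<forall>s\<le>n. x s = y s) \<Longrightarrow> R x = R y" "x \<in> paths R" "\<forall>s\<le>n. y s = x s" for R x y
    using that unfolding paths_def by blast
  have measurable_hist: "{\<omega> \<in> space M. R (\<lambda>s. X s \<omega>)} \<in> sets M"
    if R: "\<And>x y. (\<forall>s\<le>n. x s = y s) \<Longrightarrow> R x = R y" for R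
  proof -
    have "{\<omega> \<in> space M. R (\<lambda>s. X s \<omega>)} = (\<Union>x\<in>paths R. {\<omega> \<in> space M. \<forall>s\<le>n. X s \<omega> = x s})"
      using path_eq[of _ R] paths_iff[of R, OF R] by auto
    then show ?thesis
      using finite by auto
  qed
  show "{\<omega> \<in> space M. Q (\<lambda>s. X s \<omega>)} \<in> sets M"
    using hist by (rule measurable_hist)
  \<comment> \<open>With the last state included in the predicate, the transition factor is
    \<open>P $ k $ j\<close> for every path in \<open>paths R\<close> and can be pulled out of the
    sum.\<close>
  define R where "R x \<longleftrightarrow> Q x \<and> x n = k" for x
  have R: "R x = R y" if "\<forall>s\<le>n. x s = y s" for x y
    using hist[OF that] that by (simp add: R_def)
  have [measurable]: "{\<omega> \<in> space M. R (\<lambda>s. X s \<omega>)} \<in> sets M"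
    using R by (rule measurable_hist)
  have "\<P>(\<omega> in M. R (\<lambda>s. X s \<omega>) \<and> X (Suc n) \<omega> = j)
      = (\<Sum>x\<in>paths R. \<P>(\<omega> in M. (\<forall>s\<le>n. X s \<omega> = x s) \<and> X (Suc n) \<omega> = j))"
  proof (intro prob_sum AE_I2 conjI ballI impI)
    fix x \<omega> assume "x \<in> paths R" "(\<forall>s\<le>n. X s \<omega> = x s) \<and> X (Suc n) \<omega> = j"
    then show "R (\<lambda>s. X s \<omega>)" "X (Suc n) \<omega> = j"
      using pathsD[of R x "\<lambda>s. X s \<omega>"] R by blast+
  next
    fix \<omega> assume "R (\<lambda>s. X s \<omega>) \<and> X (Suc n) \<omega> = j"
    then show "\<exists>!x\<in>paths R. (\<forall>s\<le>n. X s \<omega> = x s) \<and> X (Suc n) \<omega> = j"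
      using ex1[of R "\<lambda>s. X s \<omega>"] R by simp
  qed (use finite in measurable)
  also have "\<dots> = (\<Sum>x\<in>paths R. \<P>(\<omega> in M. \<forall>s\<le>n. X s \<omega> = x s) * P $ k $ j)"
    by (intro sum.cong refl) (simp add: markov_chain_path_step[OF chain], simp add: paths_def R_def)
  also have "\<dots> = \<P>(\<omega> in M. R (\<lambda>s. X s \<omega>)) * P $ k $ j"
    unfolding sum_distrib_right[symmetric]
  proof (intro arg_cong2[where f = times] prob_sum[symmetric] refl AE_I2 conjI ballI impI)
    fix x \<omega> assume "x \<in> paths R" "\<forall>s\<le>n. X s \<omega> = x s"
    then show "R (\<lambda>s. X s \<omega>)"
      using pathsD[of R x "\<lambda>s. X s \<omega>"] R by blast
  next
    fix \<omega> assume "R (\<lambda>s. X s \<omega>)"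
    then show "\<exists>!x\<in>paths R. \<forall>s\<le>n. X s \<omega> = x s"
      using ex1[of R "\<lambda>s. X s \<omega>"] R by blast
  qed (use finite in measurable)
  finally show "\<P>(\<omega> in M. (Q (\<lambda>s. X s \<omega>) \<and> X n \<omega> = k) \<and> X (Suc n) \<omega> = j)
       = \<P>(\<omega> in M. Q (\<lambda>s. X s \<omega>) \<and> X n \<omega> = k) * P $ k $ j"
    by (simp add: R_def)
qed

text \<open>Induction on \<open>m\<close>: split by the state at time \<open>n + m\<close>, then
  take one more step as in the recursion of \<open>matrix_power\<close>.\<close>

lemma markov_chain_steps:
  fixes P :: "real^'a^'a :: finite"
  assumes chain: "markov_chain M X P \<mu>"
    and hist: "\<And>x y. (\<forall>s\<le>n. x s = y s) \<Longrightarrow> Q x = Q y"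
  shows "\<P>(\<omega> in M. (Q (\<lambda>s. X s \<omega>) \<and> X n \<omega> = k) \<and> X (n + m) \<omega> = j)
       = \<P>(\<omega> in M. Q (\<lambda>s. X s \<omega>) \<and> X n \<omega> = k) * matrix_power P m $ k $ j"
proof (induction m arbitrary: j)
  case 0
  have "\<P>(\<omega> in M. (Q (\<lambda>s. X s \<omega>) \<and> X n \<omega> = k) \<and> X n \<omega> = j)
      = (if k = j then \<P>(\<omega> in M. Q (\<lambda>s. X s \<omega>) \<and> X n \<omega> = k) else 0)"
    by (auto intro!: arg_cong[where f = "measure M"])
      (metis (mono_tags, lifting) Collect_empty_eq measure_empty)
  then show ?case
    by (simp add: mat_def)
next
  case (Suc m)
  interpret prob_space M using chain by (rule markov_chain_prob_space)
  note [measurable] = markov_chain_measurable[OF chain]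
  have [measurable]: "{\<omega> \<in> space M. Q (\<lambda>s. X s \<omega>)} \<in> sets M"
    using markov_chain_history_measurable[OF chain, of n Q] hist by blast
  \<comment> \<open>The condition at time \<open>n\<close> becomes part of the history, so that the
    one-step lemma applies at time \<open>n + m\<close>.\<close>
  let ?Q = "\<lambda>x. Q x \<and> x n = k"
  have hist': "?Q x = ?Q y" if "\<forall>s\<le>n + m. x s = y s" for x y
    using hist[of x y] that by simp
  have "\<P>(\<omega> in M. ?Q (\<lambda>s. X s \<omega>) \<and> X (n + Suc m) \<omega> = j)
      = (\<Sum>l\<in>UNIV. \<P>(\<omega> in M. (?Q (\<lambda>s. X s \<omega>) \<and> X (n + m) \<omega> = l) \<and> X (Suc (n + m)) \<omega> = j))"
    by (intro prob_sum) auto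
  also have "\<dots> = (\<Sum>l\<in>UNIV. \<P>(\<omega> in M. ?Q (\<lambda>s. X s \<omega>) \<and> X (n + m) \<omega> = l) * P $ l $ j)"
    using markov_chain_step[OF chain, of "n + m" ?Q] hist' by (intro sum.cong refl) blast
  also have "\<dots> = \<P>(\<omega> in M. ?Q (\<lambda>s. X s \<omega>)) * matrix_power P (Suc m) $ k $ j"
    unfolding Suc.IH by (simp add: matrix_matrix_mult_def sum_distrib_left mult.assoc)
  finally show ?case .
qed

section \<open>Stationarity and first visits\<close>

lemma stationary_distribution_power:
  assumes "stationary_distribution P \<pi>"
  shows "\<pi> v* matrix_power P n = \<pi>"
  using assms
  by (induction n) (auto simp: stationary_distribution_def simp flip: vector_matrix_mul_assoc)

lemma stationary_distribution_nonneg: "stationary_distribution P \<pi> \<Longrightarrow> 0 \<le> \<pi> $ i"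
  by (simp add: stationary_distribution_def probability_vector_def)

lemma matrix_power_nonneg:
  "stochastic_matrix P \<Longrightarrow> 0 \<le> matrix_power P n $ i $ j"
  by (induction n arbitrary: i j)
     (auto simp: mat_def matrix_matrix_mult_def stochastic_matrix_def intro!: sum_nonneg)

lemma stationary_markov_chain_prob:
  assumes chain: "markov_chain M X P \<pi>" and stationary: "stationary_distribution P \<pi>"
  shows "\<P>(\<omega> in M. X n \<omega> = j) = \<pi> $ j"
proof -
  interpret prob_space M using chain by (rule markov_chain_prob_space)
  note [measurable] = markov_chain_measurable[OF chain]
  have "\<P>(\<omega> in M. X n \<omega> = j) = (\<Sum>i\<in>UNIV. \<P>(\<omega> in M. X 0 \<omega> = i \<and> X n \<omega> = j))"
    by (intro prob_sum) auto
  also have "\<dots> = (\<Sum>i\<in>UNIV. \<pi> $ i * matrix_power P n $ i $ j)"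
    using markov_chain_steps[OF chain, where n = 0 and Q = "\<lambda>_. True" and m = n and j = j] chain
    by (simp add: markov_chain_def)
  also have "\<dots> = (\<pi> v* matrix_power P n) $ j"
    by (simp add: vector_matrix_mult_def mult.commute)
  finally show ?thesis
    by (simp add: stationary_distribution_power[OF stationary])
qed

lemma hitting_time_measurable:
  assumes "\<And>t. X t \<in> measurable M (count_space UNIV)"
  shows "hitting_time X i \<in> measurable M (count_space UNIV)"
proof -
  have ev: "{\<omega> \<in> space M. hitting_time X i \<omega> = enat t} \<in> sets M" for t
    unfolding hitting_time_eq_iff using assms by measurable
  have "hitting_time X i -` {y} \<inter> space M \<in> sets M" for y
  proof (cases y)
    case (enat t)
    then show ?thesis
      using ev[of t] by (auto simp: vimage_def Int_def conj_commute)
  next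
    case infinity
    \<comment> \<open>The infinite value is the complement of countably many events.\<close>
    have "hitting_time X i -` {\<infinity>} \<inter> space M
        = space M - (\<Union>t. {\<omega> \<in> space M. hitting_time X i \<omega> = enat t})"
      by auto
    also have "\<dots> \<in> sets M"
      using ev by auto
    finally show ?thesis
      using infinity by simp
  qed
  then show ?thesis
    by (subst measurable_count_space_eq_countable) auto
qed

text \<open>First-passage decomposition: if the chain is at \<open>z\<close> at time
  \<open>n\<close>, its first visit to \<open>z\<close> occurred at a unique
  \<open>t \<le> n\<close>, after which it returned in \<open>n - t\<close> steps. Stationarity
  makes the total probability the same for every \<open>n\<close>.\<close>

lemma hitting_time_renewal:
  assumes chain: "markov_chain M X P \<pi>" and stationary: "stationary_distribution P \<pi>"
  shows "(\<Sum>t=0..n. \<P>(\<omega> in M. hitting_time X z \<omega> = enat t) * matrix_power P (n - t) $ z $ z)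
       = \<pi> $ z"
proof -
  interpret prob_space M using chain by (rule markov_chain_prob_space)
  note [measurable] = markov_chain_measurable[OF chain]
  note [measurable] = hitting_time_measurable[OF markov_chain_measurable, OF chain]
  have "\<P>(\<omega> in M. hitting_time X z \<omega> = enat t) * matrix_power P (n - t) $ z $ z
      = \<P>(\<omega> in M. hitting_time X z \<omega> = enat t \<and> X n \<omega> = z)" if "t \<in> {0..n}" for t
    \<comment> \<open>Avoiding \<open>z\<close> before time \<open>t\<close> is a history condition;
      together with \<open>X t \<omega> = z\<close> it says that the first visit is at
      \<open>t\<close>.\<close>
    using markov_chain_steps[OF chain, of t "\<lambda>x. \<forall>s<t. x s \<noteq> z" z "n - t" z] that
    by (simp add: hitting_time_eq_iff conj_commute)
  then have "(\<Sum>t=0..n. \<P>(\<omega> in M. hitting_time X z \<omega> = enat t) * matrix_power P (n - t) $ z $ z)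
      = (\<Sum>t=0..n. \<P>(\<omega> in M. hitting_time X z \<omega> = enat t \<and> X n \<omega> = z))"
    by (intro sum.cong) auto
  also have "\<dots> = \<P>(\<omega> in M. X n \<omega> = z)"
  proof (intro prob_sum[symmetric] AE_I2 conjI impI)
    fix \<omega> assume n: "X n \<omega> = z"
    obtain t where t: "X t \<omega> = z" "\<forall>s<t. X s \<omega> \<noteq> z"
      using n exists_least_iff[of "\<lambda>t. X t \<omega> = z"] by blast
    then have "hitting_time X z \<omega> = enat t"
      by (simp add: hitting_time_eq_iff)
    moreover have "t \<le> n"
      using t n by (meson not_le)
    ultimately show "\<exists>!t\<in>{0..n}. hitting_time X z \<omega> = enat t \<and> X n \<omega> = z"
      using n by auto
  qed auto
  also have "\<dots> = \<pi> $ z"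
    by (rule stationary_markov_chain_prob[OF chain stationary])
  finally show ?thesis .
qed

text \<open>If state \<open>i\<close> has positive mass, irreducibility carries some of it to
  another state \<open>j\<close>, so by stationarity \<open>j\<close> has positive mass as well and
  \<open>i\<close> cannot have mass 1.\<close>

lemma stationary_distribution_less_1:
  fixes P :: "real^'a^'a :: finite"
  assumes "2 \<le> CARD('a)" "stochastic_matrix P" "irreducible_chain P"
    and stationary: "stationary_distribution P \<pi>"
  shows "\<pi> $ i < 1"
proof (cases "\<pi> $ i = 0")
  case False
  then have "0 < \<pi> $ i"
    using stationary_distribution_nonneg[OF stationary, of i] by simp
  have "\<not> card (UNIV :: 'a set) \<le> card {i}"
    using assms(1) by simp
  then obtain j where "j \<noteq> i"
    by (metis card_mono finite.emptyI finite.insertI subsetI insertI1)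
  obtain t where "0 < matrix_power P t $ i $ j"
    using assms(3) by (auto simp: irreducible_chain_def)
  then have "0 < \<pi> $ i * matrix_power P t $ i $ j"
    using \<open>0 < \<pi> $ i\<close> by simp
  also have "\<dots> \<le> (\<Sum>k\<in>UNIV. \<pi> $ k * matrix_power P t $ k $ j)"
    using matrix_power_nonneg[OF assms(2)] stationary_distribution_nonneg[OF stationary]
    by (intro member_le_sum) auto
  also have "\<dots> = (\<pi> v* matrix_power P t) $ j"
    by (simp add: vector_matrix_mult_def mult.commute)
  also have "\<dots> = \<pi> $ j"
    by (simp add: stationary_distribution_power[OF stationary])
  finally have "\<pi> $ i < \<pi> $ i + \<pi> $ j"
    by simp
  also have "\<dots> = (\<Sum>k\<in>{i, j}. \<pi> $ k)"
    using \<open>j \<noteq> i\<close> by simp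
  also have "\<dots> \<le> (\<Sum>k\<in>UNIV. \<pi> $ k)"
    using stationary_distribution_nonneg[OF stationary] by (intro sum_mono2) auto
  also have "\<dots> = 1"
    using stationary by (simp add: stationary_distribution_def probability_vector_def)
  finally show ?thesis .
qed simp

subsection \<open>Generating functions of random sums\<close>

text \<open>A formal series, so identities are compared coefficient by coefficient and no radius of
  convergence enters.\<close>

definition prob_gen_fun :: "'w measure \<Rightarrow> ('w \<Rightarrow> nat) \<Rightarrow> real fps" where
  "prob_gen_fun M X = Abs_fps (\<lambda>n. \<P>(\<omega> in M. X \<omega> = n))"

lemma prob_gen_fun_nth: "fps_nth (prob_gen_fun M X) n = \<P>(\<omega> in M. X \<omega> = n)"
  by (simp add: prob_gen_fun_def)

lemma prob_gen_fun_distr: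
  assumes "X \<in> measurable M (count_space UNIV)"
  shows "prob_gen_fun (distr M (count_space UNIV) X) (\<lambda>x. x) = prob_gen_fun M X"
  using assms
  by (auto simp: fps_eq_iff prob_gen_fun_nth measure_distr vimage_def intro!: arg_cong[where f = "measure M"])

context prob_space
begin

lemma prob_gen_fun_add:
  assumes "indep_var (count_space UNIV) X (count_space UNIV) Y"
  shows "prob_gen_fun M (\<lambda>\<omega>. X \<omega> + Y \<omega>) = prob_gen_fun M X * prob_gen_fun M Y"
proof (rule fps_ext)
  fix n
  note [measurable] = indep_var_rv1[OF assms] indep_var_rv2[OF assms]
  \<comment> \<open>The subtraction on \<open>nat\<close> is exact because \<open>i\<close> runs
    only up to \<open>n\<close>; the sum is the Cauchy product of the coefficients.\<close>
  have "\<P>(\<omega> in M. X \<omega> + Y \<omega> = n) = (\<Sum>i=0..n. \<P>(\<omega> in M. X \<omega> = i \<and> Y \<omega> = n - i))"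
    by (intro prob_sum) auto
  also have "\<dots> = (\<Sum>i=0..n. \<P>(\<omega> in M. X \<omega> = i) * \<P>(\<omega> in M. Y \<omega> = n - i))"
  proof (intro sum.cong refl)
    fix i
    show "\<P>(\<omega> in M. X \<omega> = i \<and> Y \<omega> = n - i) = \<P>(\<omega> in M. X \<omega> = i) * \<P>(\<omega> in M. Y \<omega> = n - i)"
      using indep_varD[OF assms, of "{i}" "{n - i}"] by (simp add: vimage_def Int_def conj_commute)
  qed
  finally show "fps_nth (prob_gen_fun M (\<lambda>\<omega>. X \<omega> + Y \<omega>)) n
      = fps_nth (prob_gen_fun M X * prob_gen_fun M Y) n"
    by (simp add: prob_gen_fun_nth fps_mult_nth)
qed

lemma prob_gen_fun_0: "prob_gen_fun M (\<lambda>_. 0) = 1"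
  by (auto simp: fps_eq_iff prob_gen_fun_nth prob_space)

lemma prob_gen_fun_sum:
  fixes V :: "'i \<Rightarrow> 'a \<Rightarrow> nat"
  assumes "finite I" "indep_vars (\<lambda>_. count_space UNIV) V I"
  shows "prob_gen_fun M (\<lambda>\<omega>. \<Sum>i\<in>I. V i \<omega>) = (\<Prod>i\<in>I. prob_gen_fun M (V i))"
  using assms
proof (induction I)
  case empty
  show ?case by (simp add: prob_gen_fun_0)
next
  case (insert j I)
  have comp: "(\<lambda>x. \<Sum>i\<in>I. x i) \<in> measurable (Pi\<^sub>M I (\<lambda>_. count_space UNIV)) (count_space (UNIV :: nat set))"
    by measurable
  \<comment> \<open>\<open>V j\<close> and the remaining sum are measurable functions of the
    disjoint blocks of coordinates \<open>{j}\<close> and \<open>I\<close>, hence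
    independent.\<close>
  have "indep_var (count_space UNIV) ((\<lambda>x. x j) \<circ> (\<lambda>\<omega>. restrict (\<lambda>i. V i \<omega>) {j}))
      (count_space UNIV) ((\<lambda>x. \<Sum>i\<in>I. x i) \<circ> (\<lambda>\<omega>. restrict (\<lambda>i. V i \<omega>) I))"
    using insert.hyps by (intro indep_var_compose[OF indep_var_restrict[OF insert.prems]] comp) auto
  also have "(\<lambda>x. x j) \<circ> (\<lambda>\<omega>. restrict (\<lambda>i. V i \<omega>) {j}) = V j"
    by auto
  also have "(\<lambda>x. \<Sum>i\<in>I. x i) \<circ> (\<lambda>\<omega>. restrict (\<lambda>i. V i \<omega>) I) = (\<lambda>\<omega>. \<Sum>i\<in>I. V i \<omega>)"
    by auto
  finally have "prob_gen_fun M (\<lambda>\<omega>. V j \<omega> + (\<Sum>i\<in>I. V i \<omega>))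
      = prob_gen_fun M (V j) * prob_gen_fun M (\<lambda>\<omega>. \<Sum>i\<in>I. V i \<omega>)"
    by (rule prob_gen_fun_add)
  also have "prob_gen_fun M (\<lambda>\<omega>. \<Sum>i\<in>I. V i \<omega>) = (\<Prod>i\<in>I. prob_gen_fun M (V i))"
    using indep_vars_subset[OF insert.prems] by (intro insert.IH) auto
  finally show ?case
    using insert.hyps by simp
qed

lemma random_sum_measurable:
  fixes V :: "nat \<Rightarrow> 'a \<Rightarrow> nat"
  assumes N: "N \<in> measurable M (count_space UNIV)"
    and V: "\<And>i. 1 \<le> i \<Longrightarrow> V i \<in> measurable M (count_space UNIV)"
  shows "(\<lambda>\<omega>. \<Sum>i = 1..N \<omega>. V i \<omega>) \<in> measurable M (count_space UNIV)"
proof (rule measurable_compose_countable[OF _ N])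
  fix k :: nat
  show "(\<lambda>\<omega>. \<Sum>i = 1..k. V i \<omega>) \<in> measurable M (count_space UNIV)"
    using V by (intro measurable_sum_nat) auto
qed

section \<open>Random sums and power series identities\<close>

text \<open>Split by the value of \<open>N\<close>. On \<open>N \<omega> = k\<close> the random sum
  has the fixed range \<open>{1..k}\<close>; independence from \<open>N\<close> factors the
  probability, and independence of the summands gives the power \<open>G ^ k\<close>.\<close>

lemma random_sum_sums:
  fixes V :: "nat \<Rightarrow> 'a \<Rightarrow> nat"
  assumes N: "N \<in> measurable M (count_space UNIV)"
    and V: "indep_vars (\<lambda>_. count_space UNIV) V {1..}"
    and indep: "indep_set (sets (vimage_algebra (space M) N (count_space UNIV)))
                 (sets (vimage_algebra (space M) (\<lambda>\<omega>. \<lambda>i\<in>{1..}. V i \<omega>)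
                    (Pi\<^sub>M {1..} (\<lambda>_. count_space UNIV))))"
    and G: "\<And>i. 1 \<le> i \<Longrightarrow> prob_gen_fun M (V i) = G"
  shows "(\<lambda>k. \<P>(\<omega> in M. N \<omega> = k) * fps_nth (G ^ k) n)
           sums \<P>(\<omega> in M. (\<Sum>i = 1..N \<omega>. V i \<omega>) = n)"
proof -
  have V': "V i \<in> measurable M (count_space UNIV)" if "1 \<le> i" for i
    using V that by (auto simp: indep_vars_def)
  note [measurable] = N random_sum_measurable[OF N V']
  have "\<P>(\<omega> in M. N \<omega> = k) * fps_nth (G ^ k) n
      = \<P>(\<omega> in M. N \<omega> = k \<and> (\<Sum>i = 1..N \<omega>. V i \<omega>) = n)" for k
  proof -
    \<comment> \<open>The whole sequence is viewed as one point of the product space. A partial sum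
      is a measurable function of it, so its events lie in the sigma-algebra assumed independent of
      \<open>N\<close>.\<close>
    let ?W = "\<lambda>\<omega>. \<lambda>i\<in>{1..}. V i \<omega>" and ?Pi = "Pi\<^sub>M {1::nat..} (\<lambda>_. count_space (UNIV :: nat set))"
    have "indep_vars (\<lambda>_. count_space UNIV) V {1..k}"
      using V by (rule indep_vars_subset) auto
    then have "prob_gen_fun M (\<lambda>\<omega>. \<Sum>i = 1..k. V i \<omega>) = G ^ k"
      using G by (simp add: prob_gen_fun_sum)
    then have Gk: "fps_nth (G ^ k) n = \<P>(\<omega> in M. (\<Sum>i = 1..k. V i \<omega>) = n)"
      by (metis prob_gen_fun_nth)
    have component: "(\<lambda>x. x i) \<in> measurable ?Pi (count_space UNIV)" if "1 \<le> i" for i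
      using that by (intro measurable_component_singleton) auto
    have "(\<lambda>x. \<Sum>i = 1..k. x i) \<in> measurable ?Pi (count_space UNIV)"
      using component by (intro measurable_sum_nat) auto
    then have "(\<lambda>x. \<Sum>i = 1..k. x i) -` {n} \<inter> space ?Pi \<in> sets ?Pi"
      by (rule measurable_sets) simp
    from in_vimage_algebra[OF this, of ?W "space M"]
    have "?W -` ((\<lambda>x. \<Sum>i = 1..k. x i) -` {n} \<inter> space ?Pi) \<inter> space M
        \<in> sets (vimage_algebra (space M) ?W ?Pi)" .
    also have "?W -` ((\<lambda>x. \<Sum>i = 1..k. x i) -` {n} \<inter> space ?Pi) \<inter> space M
        = {\<omega> \<in> space M. (\<Sum>i = 1..k. V i \<omega>) = n}"
      by (auto simp: space_PiM)
    finally have sum_event: "{\<omega> \<in> space M. (\<Sum>i = 1..k. V i \<omega>) = n}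
        \<in> sets (vimage_algebra (space M) ?W ?Pi)" .
    have "{\<omega> \<in> space M. N \<omega> = k} = N -` {k} \<inter> space M"
      by auto
    also have "\<dots> \<in> sets (vimage_algebra (space M) N (count_space UNIV))"
      by (rule in_vimage_algebra) simp
    finally have "\<P>(\<omega> in M. N \<omega> = k) * \<P>(\<omega> in M. (\<Sum>i = 1..k. V i \<omega>) = n)
        = prob ({\<omega> \<in> space M. N \<omega> = k} \<inter> {\<omega> \<in> space M. (\<Sum>i = 1..k. V i \<omega>) = n})"
      using indep_setD[OF indep _ sum_event] by simp
    also have "{\<omega> \<in> space M. N \<omega> = k} \<inter> {\<omega> \<in> space M. (\<Sum>i = 1..k. V i \<omega>) = n}
        = {\<omega> \<in> space M. N \<omega> = k \<and> (\<Sum>i = 1..N \<omega>. V i \<omega>) = n}"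
      by auto
    finally show ?thesis
      by (simp add: Gk)
  qed
  moreover have "(\<lambda>k. \<P>(\<omega> in M. N \<omega> = k \<and> (\<Sum>i = 1..N \<omega>. V i \<omega>) = n))
      sums \<P>(\<omega> in M. (\<Sum>i = 1..N \<omega>. V i \<omega>) = n)"
    by (intro prob_sums) (auto simp del: One_nat_def)
  ultimately show ?thesis
    by simp
qed

end

text \<open>This is the geometric series \<open>H = c / (1 - W)\<close>. A zero constant term of
  \<open>W\<close> leaves only finitely many nonzero contributions to each coefficient.\<close>

lemma fps_geometric_sums:
  fixes W H :: "'a :: {comm_ring_1, t2_space, topological_comm_monoid_add} fps"
  assumes W: "fps_nth W 0 = 0"
    and H: "\<And>n. (\<lambda>k. c * fps_nth (W ^ k) n) sums fps_nth H n"
  shows "H * (1 - W) = fps_const c"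
proof (rule fps_ext)
  fix n
  have zero: "fps_nth (W ^ k) i = 0" if "i < k" for i k
    using startsby_zero_power_prefix[OF W] that by blast
  \<comment> \<open>Powers \<open>W ^ k\<close> with \<open>k > n\<close> start beyond degree
    \<open>n\<close>, so up to that degree \<open>H\<close> agrees with a finite geometric
    sum.\<close>
  have nth: "fps_nth H i = fps_nth (fps_const c * (\<Sum>k\<le>n. W ^ k)) i" if "i \<le> n" for i
  proof -
    have "(\<lambda>k. c * fps_nth (W ^ k) i) sums (\<Sum>k\<le>n. c * fps_nth (W ^ k) i)"
      using that zero by (intro sums_finite) auto
    then show ?thesis
      using H[of i] sums_unique2 by (fastforce simp: fps_sum_nth sum_distrib_left)
  qed
  have "fps_nth (H * (1 - W)) n = fps_nth (fps_const c * (\<Sum>k\<le>n. W ^ k) * (1 - W)) n"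
    using nth by (simp add: fps_mult_nth del: fps_mult_left_const_nth)
  \<comment> \<open>The finite sum telescopes, and its remainder \<open>W ^ Suc n\<close> has no
    coefficient of degree \<open>n\<close>.\<close>
  also have "fps_const c * (\<Sum>k\<le>n. W ^ k) * (1 - W) = fps_const c * (1 - W ^ Suc n)"
    unfolding sum_gp_basic[of W n, symmetric] by (simp only: mult_ac)
  also have "fps_nth \<dots> n = fps_nth (fps_const c) n"
    using zero[of n "Suc n"] by simp
  finally show "fps_nth (H * (1 - W)) n = fps_nth (fps_const c) n" .
qed

text \<open>Multiplication by \<open>1 - fps_X\<close> takes successive differences: a point mass at
  \<open>n > 0\<close> is the drop of the tail from \<open>n - 1\<close> to \<open>n\<close>, while
  at 0 it is one minus the first tail.\<close>

lemma (in prob_space) prob_gen_fun_tail: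
  assumes X: "X \<in> measurable M (count_space UNIV)"
  shows "1 - prob_gen_fun M X = (1 - fps_X) * Abs_fps (\<lambda>n. \<P>(\<omega> in M. X \<omega> > n))"
proof (rule fps_ext)
  fix n
  note [measurable] = X
  show "fps_nth (1 - prob_gen_fun M X) n
      = fps_nth ((1 - fps_X) * Abs_fps (\<lambda>n. \<P>(\<omega> in M. X \<omega> > n))) n"
  proof (cases n)
    case 0
    have "\<P>(\<omega> in M. X \<omega> = 0) = \<P>(\<omega> in M. \<not> X \<omega> > 0)"
      by simp
    also have "\<dots> = 1 - \<P>(\<omega> in M. X \<omega> > 0)"
      by (rule prob_neg) measurable
    finally show ?thesis
      using 0 by (simp add: prob_gen_fun_nth)
  next
    case (Suc m)
    have "{\<omega> \<in> space M. X \<omega> = n} = {\<omega> \<in> space M. X \<omega> > m} - {\<omega> \<in> space M. X \<omega> > n}"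
      using Suc by auto
    then have "\<P>(\<omega> in M. X \<omega> = n) = \<P>(\<omega> in M. X \<omega> > m) - \<P>(\<omega> in M. X \<omega> > n)"
      using Suc by (simp add: finite_measure_Diff Collect_mono_iff)
    then show ?thesis
      using Suc by (simp add: prob_gen_fun_nth left_diff_distrib)
  qed
qed

section \<open>Identification of the two laws\<close>

theorem theorem4p2:
  fixes P :: "real^'a^'a :: finite"
    and \<pi> :: "real^'a"
    and z :: 'a
    and M :: "'w measure" and X :: "nat \<Rightarrow> 'w \<Rightarrow> 'a"
    and K :: "'k measure" and V\<^sub>0 :: "'k \<Rightarrow> nat"
    and L :: "'l measure" and V :: "nat \<Rightarrow> 'l \<Rightarrow> nat" and N :: "'l \<Rightarrow> nat"
  assumes two_states: "2 \<le> CARD('a)"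
    and stochastic: "stochastic_matrix P"
    and ergodic: "ergodic_chain P"
    and stationary: "stationary_distribution P \<pi>"
    and reversible: "time_reversible P \<pi>"
    and nonincreasing: "antimono (\<lambda>t. matrix_power P t $ z $ z)"
    and chain: "markov_chain M X P \<pi>"
    and prob_K: "prob_space K"
    and V\<^sub>0_measurable: "V\<^sub>0 \<in> measurable K (count_space UNIV)"
    and V\<^sub>0_tail: "\<And>t. \<P>(\<omega> in K. V\<^sub>0 \<omega> > t) = (matrix_power P t $ z $ z - \<pi> $ z) / (1 - \<pi> $ z)"
    and prob_L: "prob_space L"
    and V_indep: "prob_space.indep_vars L (\<lambda>_. count_space UNIV) V {1..}"
    and V_copies: "\<And>i. 1 \<le> i \<Longrightarrow> distr L (count_space UNIV) (V i) = distr K (count_space UNIV) V\<^sub>0"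
    and N_measurable: "N \<in> measurable L (count_space UNIV)"
    and N_indep: "prob_space.indep_set L
                    (sets (vimage_algebra (space L) N (count_space UNIV)))
                    (sets (vimage_algebra (space L) (\<lambda>\<omega>. \<lambda>i\<in>{1..}. V i \<omega>)
                             (Pi\<^sub>M {1..} (\<lambda>_. count_space UNIV))))"
    and N_geometric: "\<And>k. \<P>(\<omega> in L. N \<omega> = k) = \<pi> $ z * (1 - \<pi> $ z) ^ k"
  shows "distr M (count_space UNIV) (hitting_time X z) =
         distr L (count_space UNIV) (\<lambda>\<omega>. enat (\<Sum>i = 1..N \<omega>. V i \<omega>))"
proof -
  interpret M: prob_space M using chain by (rule markov_chain_prob_space)
  interpret K: prob_space K by (rule prob_K)
  interpret L: prob_space L by (rule prob_L)
  define p where "p = \<pi> $ z"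
  define A where "A = Abs_fps (\<lambda>t. matrix_power P t $ z $ z)"
  define F where "F = Abs_fps (\<lambda>t. \<P>(\<omega> in M. hitting_time X z \<omega> = enat t))"
  define H where "H = prob_gen_fun L (\<lambda>\<omega>. \<Sum>i = 1..N \<omega>. V i \<omega>)"
  define G where "G = prob_gen_fun K V\<^sub>0"
  define E :: "real fps" where "E = Abs_fps (\<lambda>_. 1)"
  have V_measurable: "V i \<in> measurable L (count_space UNIV)" if "1 \<le> i" for i
    using V_indep that by (auto simp: L.indep_vars_def)
  have V_gen_fun: "prob_gen_fun L (V i) = G" if "1 \<le> i" for i
    using V_copies[OF that] prob_gen_fun_distr[OF V_measurable[OF that]]
      prob_gen_fun_distr[OF V\<^sub>0_measurable] by (simp add: G_def)
  \<comment> \<open>This makes the denominator in the tail formula nonzero; division by zero would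
    return 0.\<close>
  have p: "p < 1"
    using stationary_distribution_less_1[OF two_states stochastic _ stationary] ergodic
    by (simp add: ergodic_chain_def p_def)
  have A0: "fps_nth A 0 = 1"
    by (simp add: A_def mat_def)
  \<comment> \<open>\<open>E\<close> is the series of \<open>1 / (1 - x)\<close>;
    \<open>fps_const p * E\<close> has every coefficient equal to \<open>p\<close>.\<close>
  have E: "(1 - fps_X) * E = 1"
    unfolding E_def fps_inverse_gp'[symmetric] by (rule inverse_mult_eq_1) simp
  have FA: "F * A = fps_const p * E"
    using hitting_time_renewal[OF chain stationary]
    by (simp add: fps_eq_iff fps_mult_nth F_def A_def E_def p_def)
  \<comment> \<open>The tail formula for \<open>V\<^sub>0\<close>, multiplied by
    \<open>1 - p\<close> and collected over all times.\<close>
  have "fps_const (1 - p) * Abs_fps (\<lambda>n. \<P>(\<omega> in K. V\<^sub>0 \<omega> > n)) = A - fps_const p * E"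
    using p by (auto simp: fps_eq_iff V\<^sub>0_tail A_def E_def p_def)
  moreover have "1 - G = (1 - fps_X) * Abs_fps (\<lambda>n. \<P>(\<omega> in K. V\<^sub>0 \<omega> > n))"
    unfolding G_def by (rule K.prob_gen_fun_tail[OF V\<^sub>0_measurable])
  ultimately have "fps_const (1 - p) * (1 - G) = (1 - fps_X) * (A - fps_const p * E)"
    by (simp add: mult.left_commute)
  also have "\<dots> = (1 - fps_X) * A - fps_const p * ((1 - fps_X) * E)"
    by (simp add: algebra_simps)
  finally have "fps_const (1 - p) - fps_const (1 - p) * G = (1 - fps_X) * A - fps_const p"
    by (simp only: E right_diff_distrib mult_1_right)
  moreover have "fps_const (1 - p) = 1 - fps_const p"
    by (simp flip: fps_const_1_eq_1 fps_const_sub)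
  moreover have "1 - x = y" if "a - x = y - q" "a = 1 - q" for a x y q :: "real fps"
    using that by (simp add: algebra_simps)
  ultimately have W: "1 - fps_const (1 - p) * G = (1 - fps_X) * A"
    by metis
  \<comment> \<open>The constant term of \<open>A\<close> is 1 because the chain is at
    \<open>z\<close> at time 0 when started there. Thus \<open>V\<^sub>0\<close> has no mass at 0
    and the geometric series below is legitimate.\<close>
  have "fps_nth (1 - fps_const (1 - p) * G) 0 = 1"
    unfolding W by (simp add: A0)
  then have W0: "fps_nth (fps_const (1 - p) * G) 0 = 0"
    by simp
  \<comment> \<open>The geometric weight \<open>p * (1 - p) ^ k\<close> times \<open>G ^ k\<close>
    is \<open>p\<close> times a power of \<open>fps_const (1 - p) * G\<close>.\<close>
  have "(\<lambda>k. p * fps_nth ((fps_const (1 - p) * G) ^ k) n) sums fps_nth H n" for n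
    using L.random_sum_sums[OF N_measurable V_indep N_indep V_gen_fun, of n]
    by (simp add: N_geometric H_def prob_gen_fun_nth power_mult_distrib p_def mult.assoc)
  then have "H * (1 - fps_const (1 - p) * G) = fps_const p"
    using W0 by (rule fps_geometric_sums[rotated])
  \<comment> \<open>Both sides equal \<open>fps_const p\<close>: the left by the geometric series
    and \<open>W\<close>, the right by \<open>FA\<close> and \<open>E\<close>.\<close>
  then have "H * ((1 - fps_X) * A) = F * A * (1 - fps_X)"
    unfolding W FA using E by (simp add: mult.assoc mult.commute)
  then have "H * ((1 - fps_X) * A) = F * ((1 - fps_X) * A)"
    by (simp add: mult_ac)
  moreover have "fps_nth ((1 - fps_X) * A) 0 = 1"
    by (simp add: A0)
  \<comment> \<open>Real power series form an integral domain, so this nonzero common factor cancels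
    and \<open>F = H\<close>.\<close>
  then have "(1 - fps_X) * A \<noteq> 0"
    by auto
  ultimately have "fps_nth F n = fps_nth H n" for n
    by simp
  then have eq: "\<P>(\<omega> in M. hitting_time X z \<omega> = enat n) = \<P>(\<omega> in L. (\<Sum>i = 1..N \<omega>. V i \<omega>) = n)" for n
    by (simp add: H_def F_def prob_gen_fun_nth)
  have S: "(\<lambda>\<omega>. enat (\<Sum>i = 1..N \<omega>. V i \<omega>)) \<in> measurable L (count_space UNIV)"
    using L.random_sum_measurable[OF N_measurable V_measurable]
    by (rule measurable_compose) simp_all
  have T: "hitting_time X z \<in> measurable M (count_space UNIV)"
    using markov_chain_measurable[OF chain] by (rule hitting_time_measurable)
  show ?thesis
  proof (rule prob_space_eqI_enat)
    fix n
    show "measure (distr M (count_space UNIV) (hitting_time X z)) {enat n} =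
          measure (distr L (count_space UNIV) (\<lambda>\<omega>. enat (\<Sum>i = 1..N \<omega>. V i \<omega>))) {enat n}"
      using eq[of n]
      by (simp add: measure_distr S T vimage_def Int_def conj_commute del: One_nat_def)
  qed (simp_all add: M.prob_space_distr[OF T] L.prob_space_distr[OF S] del: One_nat_def)
qed

end
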